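(* Let $(\rho(\theta))_{\theta\in\mathbb{R}^L}$ be a second-order differentiable family of positive definite states on a finite-dimensional Hilbert space. For $\alpha=2$, the sandwiched Rényi information matrix satisfies $$[\widetilde I_2(\theta)]_{i,j}=\mathrm{Tr}\left[\rho(\theta)^{-\frac12}(\partial_i\rho(\theta))\rho(\theta)^{-\frac12}(\partial_j\rho(\theta))\right],$$ where $\partial_i=\frac{\partial}{\partial\theta_i}$.
   Context: A state is a positive semi-definite operator of unit trace. For positive definite states $\rho,\sigma$ and $\alpha\in(0,1)\cup(1,\infty)$, the sandwiched Rényi relative entropy is $\widetilde D_\alpha(\rho\|\sigma):=\frac{1}{\alpha-1}\ln\mathrm{Tr}\big[(\sigma^{\frac{1-\alpha}{2\alpha}}\rho\,\sigma^{\frac{1-\alpha}{2\alpha}})^\alpha\big]$. The sandwiched Rényi information matrix has entries $[\widetilde I_\alpha(\theta)]_{i,j}:=\frac1\alpha\left.\frac{\partial^2}{\partial\varepsilon_i\partial\varepsilon_j}\widetilde D_\alpha(\rho(\theta)\|\rho(\theta+\varepsilon))\right|_{\varepsilon=0}$. *)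

theory Defs
  imports "HOL-Analysis.Analysis"
begin

text \<open>Operators on a finite-dimensional Hilbert space are complex square matrices.\<close>

definition adjoint_mat :: "complex^'n^'n \<Rightarrow> complex^'n^'n" where
  "adjoint_mat A = (\<chi> i j. cnj (A $ j $ i))"

definition hermitian_mat :: "complex^'n^'n \<Rightarrow> bool" where
  "hermitian_mat A \<longleftrightarrow> adjoint_mat A = A"

definition unitary_mat :: "complex^'n^'n \<Rightarrow> bool" where
  "unitary_mat U \<longleftrightarrow> adjoint_mat U ** U = mat 1 \<and> U ** adjoint_mat U = mat 1"

definition quadratic_form :: "complex^'n^'n \<Rightarrow> complex^'n \<Rightarrow> complex" where
  "quadratic_form A v = (\<Sum>k\<in>UNIV. cnj (v $ k) * (A *v v) $ k)"

text \<open>The quadratic form of a Hermitian matrix is real-valued, so taking its real part loses nothing.\<close>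

definition positive_semidefinite :: "complex^'n^'n \<Rightarrow> bool" where
  "positive_semidefinite A \<longleftrightarrow> hermitian_mat A \<and> (\<forall>v. Re (quadratic_form A v) \<ge> 0)"

definition positive_definite :: "complex^'n^'n \<Rightarrow> bool" where
  "positive_definite A \<longleftrightarrow> hermitian_mat A \<and> (\<forall>v. v \<noteq> 0 \<longrightarrow> Re (quadratic_form A v) > 0)"

definition state :: "complex^'n^'n \<Rightarrow> bool" where
  "state A \<longleftrightarrow> positive_semidefinite A \<and> trace A = 1"

definition diag_mat :: "('n \<Rightarrow> real) \<Rightarrow> complex^'n^'n" where
  "diag_mat d = (\<chi> i j. if i = j then complex_of_real (d i) else 0)"

text \<open>Real powers by functional calculus on a spectral decomposition. The value does not depend
  on the decomposition (\<open>mat_powr_eqI\<close> below); for matrices that are not Hermitian it is unspecified.\<close>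

definition mat_powr :: "complex^'n^'n \<Rightarrow> real \<Rightarrow> complex^'n^'n" where
  "mat_powr A s = (THE B. \<exists>U d. unitary_mat U \<and> A = U ** diag_mat d ** adjoint_mat U \<and>
                               B = U ** diag_mat (\<lambda>k. d k powr s) ** adjoint_mat U)"

lemma diag_mat_mult_nth: "(diag_mat d ** W) $ i $ j = complex_of_real (d i) * W $ i $ j"
  by (simp add: diag_mat_def matrix_matrix_mult_def if_distrib[of "\<lambda>x. x * _"] cong: if_cong)

lemma mult_diag_mat_nth: "(W ** diag_mat d) $ i $ j = W $ i $ j * complex_of_real (d j)"
  by (simp add: diag_mat_def matrix_matrix_mult_def if_distrib[of "\<lambda>x. _ * x"] cong: if_cong)

lemma unitary_diag_fun_unique:
  assumes U: "unitary_mat U" and V: "unitary_mat V"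
    and eq: "U ** diag_mat d ** adjoint_mat U = V ** diag_mat e ** adjoint_mat V"
  shows "U ** diag_mat (\<lambda>k. f (d k)) ** adjoint_mat U = V ** diag_mat (\<lambda>k. f (e k)) ** adjoint_mat V"
proof -
  define W where "W = adjoint_mat V ** U"
  have U1: "adjoint_mat U ** U = mat 1" "U ** adjoint_mat U = mat 1"
    and V1: "adjoint_mat V ** V = mat 1" "V ** adjoint_mat V = mat 1"
    using U V by (auto simp: unitary_mat_def)
  have "W ** diag_mat d = adjoint_mat V ** (U ** diag_mat d ** adjoint_mat U) ** U"
    by (metis U1(1) W_def matrix_mul_assoc matrix_mul_rid)
  also have "\<dots> = diag_mat e ** W"
    unfolding eq by (metis V1(1) W_def matrix_mul_assoc matrix_mul_lid)
  finally have comm: "W ** diag_mat d = diag_mat e ** W" .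
  have "W $ i $ j * complex_of_real (f (d j)) = complex_of_real (f (e i)) * W $ i $ j" for i j
  proof -
    have "W $ i $ j * complex_of_real (d j) = complex_of_real (e i) * W $ i $ j"
      using comm by (metis diag_mat_mult_nth mult_diag_mat_nth)
    then show ?thesis by (cases "W $ i $ j = 0") auto
  qed
  then have comm': "W ** diag_mat (\<lambda>k. f (d k)) = diag_mat (\<lambda>k. f (e k)) ** W"
    by (simp add: vec_eq_iff diag_mat_mult_nth mult_diag_mat_nth)
  have VW: "V ** W = U" by (simp add: W_def matrix_mul_assoc V1)
  have WU: "W ** adjoint_mat U = adjoint_mat V"
    by (metis W_def U1(2) matrix_mul_assoc matrix_mul_rid)
  have "U ** diag_mat (\<lambda>k. f (d k)) ** adjoint_mat U
      = V ** (W ** diag_mat (\<lambda>k. f (d k))) ** adjoint_mat U"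
    by (simp add: VW matrix_mul_assoc)
  also have "\<dots> = V ** diag_mat (\<lambda>k. f (e k)) ** (W ** adjoint_mat U)"
    unfolding comm' by (simp add: matrix_mul_assoc)
  finally show ?thesis by (simp add: WU)
qed

lemma mat_powr_eqI:
  assumes "unitary_mat U" "A = U ** diag_mat d ** adjoint_mat U"
  shows "mat_powr A s = U ** diag_mat (\<lambda>k. d k powr s) ** adjoint_mat U"
  unfolding mat_powr_def
proof (rule the_equality)
  show "\<exists>U' d'. unitary_mat U' \<and> A = U' ** diag_mat d' ** adjoint_mat U' \<and>
      U ** diag_mat (\<lambda>k. d k powr s) ** adjoint_mat U = U' ** diag_mat (\<lambda>k. d' k powr s) ** adjoint_mat U'"
    using assms by blast
next
  fix B assume "\<exists>U' d'. unitary_mat U' \<and> A = U' ** diag_mat d' ** adjoint_mat U' \<and>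
      B = U' ** diag_mat (\<lambda>k. d' k powr s) ** adjoint_mat U'"
  then show "B = U ** diag_mat (\<lambda>k. d k powr s) ** adjoint_mat U"
    using unitary_diag_fun_unique[OF _ assms(1), where f = "\<lambda>x. x powr s"] assms(2) by metis
qed

text \<open>For positive definite arguments the trace below is real and positive, so \<open>Re\<close> only changes its type.\<close>

definition sandwiched_renyi :: "real \<Rightarrow> complex^'n^'n \<Rightarrow> complex^'n^'n \<Rightarrow> real" where
  "sandwiched_renyi \<alpha> \<rho> \<sigma> =
     1 / (\<alpha> - 1) *
     ln (Re (trace (mat_powr (mat_powr \<sigma> ((1 - \<alpha>) / (2 * \<alpha>)) ** \<rho> ** mat_powr \<sigma> ((1 - \<alpha>) / (2 * \<alpha>))) \<alpha>)))"

definition partial_deriv :: "'l::finite \<Rightarrow> (real^'l \<Rightarrow> 'b::real_normed_vector) \<Rightarrow> real^'l \<Rightarrow> 'b" where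
  "partial_deriv i f x = vector_derivative (\<lambda>t. f (x + t *\<^sub>R axis i 1)) (at 0)"

definition twice_differentiable :: "('a::real_normed_vector \<Rightarrow> 'b::real_normed_vector) \<Rightarrow> bool" where
  "twice_differentiable f \<longleftrightarrow>
     (\<exists>f' :: 'a \<Rightarrow> 'a \<Rightarrow>\<^sub>L 'b. (\<forall>x. (f has_derivative blinfun_apply (f' x)) (at x)) \<and>
                             (\<forall>x. f' differentiable (at x)))"

definition sandwiched_renyi_info ::
  "real \<Rightarrow> (real^'l \<Rightarrow> complex^'n^'n) \<Rightarrow> real^'l \<Rightarrow> real^'l^'l" where
  "sandwiched_renyi_info \<alpha> \<rho> \<theta> =
     (\<chi> i j. 1 / \<alpha> *
        partial_deriv i (partial_deriv j (\<lambda>\<epsilon>. sandwiched_renyi \<alpha> (\<rho> \<theta>) (\<rho> (\<theta> + \<epsilon>)))) 0)"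

end

theory Submission
  imports Defs
begin

text \<open>For \<open>\<alpha> = 2\<close> the divergence is \<open>ln F\<close> with \<open>F(\<epsilon>) = trace (\<rho> S \<rho> S)\<close>, where \<open>\<rho> = \<rho>(\<theta>)\<close> and
  \<open>S = R\<^sup>-\<^sup>1\<close> for the square root \<open>R\<close> of \<open>\<sigma> = \<rho>(\<theta> + \<epsilon>)\<close>. Differentiating \<open>R\<^sup>2 = \<sigma>\<close> gives the Sylvester
  equation \<open>R R\<^sub>k + R\<^sub>k R = \<partial>\<^sub>k \<sigma>\<close>, and \<open>S\<^sub>k = - S R\<^sub>k S\<close>. Hence \<open>\<partial>\<^sub>j F = 2 trace (\<rho> S \<rho> S\<^sub>j)\<close>. Since \<open>trace \<sigma> = 1\<close>,
  the quantity \<open>trace (R\<^sup>3 S\<^sub>j) = - trace (\<partial>\<^sub>j \<sigma>) / 2\<close> vanishes, so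
  \<open>\<partial>\<^sub>j F = 2 trace ((\<rho> S \<rho> - R\<^sup>3) S\<^sub>j)\<close>, whose first factor is zero at \<open>\<epsilon> = 0\<close>. There, with all factors taken
  at \<open>\<theta>\<close>, the second derivative of \<open>ln F\<close> is that of \<open>F\<close>, namely
  \<open>2 (2 trace (R\<^sub>i R\<^sub>j) + trace (R\<^sub>i R R\<^sub>j S) + trace (R R\<^sub>i S R\<^sub>j))\<close>, and this equals
  \<open>2 trace (S (\<partial>\<^sub>i \<rho>) S (\<partial>\<^sub>j \<rho>))\<close> after substituting \<open>\<partial>\<^sub>k \<rho> = R R\<^sub>k + R\<^sub>k R\<close>.\<close>

section \<open>Matrix algebra\<close>

lemma adjoint_mat_nth [simp]: "adjoint_mat A $ i $ j = cnj (A $ j $ i)"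
  by (simp add: adjoint_mat_def)

lemma adjoint_mat_adjoint_mat [simp]: "adjoint_mat (adjoint_mat A) = A"
  by (simp add: vec_eq_iff)

lemma adjoint_mat_mult: "adjoint_mat (A ** B) = adjoint_mat B ** adjoint_mat A"
  by (simp add: vec_eq_iff matrix_matrix_mult_def mult.commute)

lemma adjoint_mat_1 [simp]: "adjoint_mat (mat 1) = mat 1"
  by (simp add: vec_eq_iff mat_def)

lemma adjoint_diag_mat [simp]: "adjoint_mat (diag_mat d) = diag_mat d"
  by (simp add: vec_eq_iff diag_mat_def)

lemma diag_mat_1: "diag_mat (\<lambda>k. 1) = mat 1"
  by (simp add: vec_eq_iff diag_mat_def mat_def)

lemma diag_mat_mult: "diag_mat d ** diag_mat e = diag_mat (\<lambda>k. d k * e k)"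
  by (simp add: vec_eq_iff diag_mat_mult_nth) (simp add: diag_mat_def)

lemma trace_adjoint_mat: "trace (adjoint_mat A) = cnj (trace A)"
  by (simp add: trace_def)

lemma trace_scaleR: "trace (c *\<^sub>R A) = c *\<^sub>R trace (A :: complex^'n^'n)"
  by (simp add: trace_def scaleR_sum_right)

lemma bounded_linear_trace: "bounded_linear (trace :: complex^'n^'n \<Rightarrow> complex)"
  by (intro linear_conv_bounded_linear[THEN iffD1] linearI) (simp_all add: trace_add trace_scaleR)

lemma bounded_linear_adjoint_mat: "bounded_linear (adjoint_mat :: complex^'n^'n \<Rightarrow> complex^'n^'n)"
  by (intro linear_conv_bounded_linear[THEN iffD1] linearI) (simp_all add: vec_eq_iff)

lemma bounded_bilinear_matrix_mult:
  "bounded_bilinear ((**) :: complex^'n^'n \<Rightarrow> complex^'n^'n \<Rightarrow> complex^'n^'n)"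
proof -
  have "linear (\<lambda>B. A ** B :: complex^'n^'n)" "linear (\<lambda>A. A ** B :: complex^'n^'n)"
    for A B :: "complex^'n^'n"
    by (auto intro!: linearI simp: matrix_add_ldistrib vec_eq_iff matrix_matrix_mult_def
        scaleR_sum_right algebra_simps sum.distrib)
  then show ?thesis
    by (simp add: bilinear_conv_bounded_bilinear[symmetric] bilinear_def)
qed

interpretation matrix_mult: bounded_bilinear
  "(**) :: complex^'n^'n \<Rightarrow> complex^'n^'n \<Rightarrow> complex^'n^'n"
  by (rule bounded_bilinear_matrix_mult)

text \<open>The Euclidean structure of the matrix type is the real Hilbert-Schmidt one, so norm
  bounds can be read off from traces.\<close>

lemma inner_matrix_eq_trace: "inner X Y = Re (trace (adjoint_mat X ** Y))" for X Y :: "complex^'n^'n"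
proof -
  have "inner X Y = (\<Sum>i\<in>UNIV. \<Sum>j\<in>UNIV. Re (cnj (X $ i $ j) * Y $ i $ j))"
    by (simp add: inner_vec_def inner_complex_def)
  also have "\<dots> = (\<Sum>j\<in>UNIV. \<Sum>i\<in>UNIV. Re (cnj (X $ i $ j) * Y $ i $ j))"
    by (rule sum.swap)
  finally show ?thesis by (simp add: trace_def matrix_matrix_mult_def)
qed

section \<open>The spectral theorem\<close>

text \<open>Closed as a level set of a continuous map, and bounded because every unitary matrix has
  the same Hilbert-Schmidt norm. Compactness supplies the maximiser in the spectral theorem.\<close>

lemma compact_unitary: "compact {U :: complex^'n^'n. unitary_mat U}"
proof -
  have eq: "{U :: complex^'n^'n. unitary_mat U} = {U. adjoint_mat U ** U = mat 1}"
    by (auto simp: unitary_mat_def matrix_left_right_inverse)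
  have "continuous_on UNIV (\<lambda>U :: complex^'n^'n. adjoint_mat U ** U)"
    by (intro matrix_mult.continuous_on continuous_intros
        linear_continuous_on[OF bounded_linear_adjoint_mat])
  then have "closed {U :: complex^'n^'n. unitary_mat U}"
    unfolding eq by (intro closed_Collect_eq continuous_on_const)
  moreover have "norm U \<le> sqrt CARD('n)" if "unitary_mat U" for U :: "complex^'n^'n"
    using that by (simp add: norm_eq_sqrt_inner inner_matrix_eq_trace unitary_mat_def trace_I)
  then have "bounded {U :: complex^'n^'n. unitary_mat U}"
    by (auto simp: bounded_iff)
  ultimately show ?thesis by (simp add: compact_eq_bounded_closed)
qed

lemma unitary_mat_mult: "unitary_mat U \<Longrightarrow> unitary_mat V \<Longrightarrow> unitary_mat (U ** V)"
  by (simp add: unitary_mat_def matrix_left_right_inverse adjoint_mat_mult)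
     (metis matrix_mul_assoc matrix_mul_lid)

lemma unitary_mat_1: "unitary_mat (mat 1)"
  by (simp add: unitary_mat_def)

text \<open>The rotation through the angle \<open>t\<close> in the plane of the axes \<open>p\<close> and \<open>q\<close> is
  \<open>exp (t K) = 1 + (cos t - 1) E + sin t K\<close>, where \<open>- K\<^sup>2 = E\<close> is the projection onto that plane.\<close>

lemma rotation_path:
  fixes p q :: "'n::finite" and z :: complex and K :: "complex^'n^'n"
  assumes "p \<noteq> q" "cmod z = 1"
    and K_def: "K = (\<chi> a b. if a = p \<and> b = q then z else if a = q \<and> b = p then - cnj z else 0)"
  obtains G :: "real \<Rightarrow> complex^'n^'n"
  where "\<And>t. unitary_mat (G t)" "G 0 = mat 1" "(G has_vector_derivative K) (at 0)"
proof
  define e where "e = (\<lambda>a. if a = p \<or> a = q then 1 else 0 :: real)"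
  define E :: "complex^'n^'n" where "E = diag_mat e"
  define G where "G t = mat 1 + (cos t - 1) *\<^sub>R E + sin t *\<^sub>R K" for t
  have zz: "z * cnj z = 1" "cnj z * z = 1"
    using assms(2) by (simp_all add: complex_norm_square[symmetric] mult.commute)
  have EE: "E ** E = E"
    by (simp add: E_def diag_mat_mult) (simp add: e_def if_distrib[of "\<lambda>x. x * _"] cong: if_cong)
  have EK: "E ** K = K" "K ** E = K"
    by (auto simp: E_def vec_eq_iff diag_mat_mult_nth mult_diag_mat_nth e_def K_def)
  have KK: "K ** K = - E"
  proof -
    have "(\<Sum>k\<in>UNIV. K $ a $ k * K $ k $ b) = (\<Sum>k\<in>{p,q}. K $ a $ k * K $ k $ b)" for a b
      by (rule sum.mono_neutral_right) (auto simp: K_def)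
    then show ?thesis
      using assms(1) zz by (auto simp: vec_eq_iff matrix_matrix_mult_def E_def K_def diag_mat_def e_def)
  qed
  have adj: "adjoint_mat (G t) = mat 1 + (cos t - 1) *\<^sub>R E - sin t *\<^sub>R K" for t
    using assms(1) by (auto simp: G_def E_def K_def vec_eq_iff diag_mat_def mat_def)
  \<comment> \<open>The cross terms of \<open>adjoint_mat (G t) ** G t\<close> cancel since
    \<open>E\<close> and \<open>K\<close> commute; what remains is
    \<open>1 + (cos^2 t + sin^2 t - 1) E\<close>.\<close>
  have "(cos t * cos t) *\<^sub>R E + (sin t * sin t) *\<^sub>R E = E" for t
    by (simp add: scaleR_add_left[symmetric] power2_eq_square[symmetric])
  then have "adjoint_mat (G t) ** G t = mat 1" for t
    unfolding adj unfolding G_def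
    by (simp add: matrix_mult.add_left matrix_mult.add_right matrix_mult.diff_left matrix_mult.diff_right
        matrix_mult.scaleR_left matrix_mult.scaleR_right EE EK KK algebra_simps)
  then show "unitary_mat (G t)" for t
    by (simp add: unitary_mat_def matrix_left_right_inverse)
  show "G 0 = mat 1" by (simp add: G_def)
  have "(G has_vector_derivative 0 + (- sin 0 *\<^sub>R E) + cos 0 *\<^sub>R K) (at 0)"
    unfolding G_def
    by (auto intro!: derivative_eq_intros simp: has_real_derivative_iff_has_vector_derivative[symmetric])
  then show "(G has_vector_derivative K) (at 0)" by simp
qed

text \<open>This is the derivative of the function maximised below along the rotation generated by
  \<open>K\<close>. The diagonal of the commutator is supported at \<open>p\<close> and
  \<open>q\<close>, with entries of opposite sign.\<close>

lemma trace_diag_commutator: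
  assumes "p \<noteq> q" and K: "K = (\<chi> a b. if a = p \<and> b = q then z else if a = q \<and> b = p then - cnj z else 0)"
    and "hermitian_mat B"
  shows "Re (trace (diag_mat w ** (B ** K - K ** B))) = 2 * (w q - w p) * Re (z * B $ q $ p)"
proof -
  have B: "cnj (B $ a $ b) = B $ b $ a" for a b
    using assms(3) by (metis adjoint_mat_nth hermitian_mat_def)
  define C where "C = B ** K - K ** B"
  have C: "C $ a $ a =
     (if a = p then - (cnj z * B $ p $ q) - z * B $ q $ p else
      if a = q then z * B $ q $ p + cnj z * B $ p $ q else 0)" for a
  proof -
    have "C $ a $ a = (\<Sum>k\<in>UNIV. B $ a $ k * K $ k $ a - K $ a $ k * B $ k $ a)"
      by (simp add: C_def matrix_matrix_mult_def sum_subtractf)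
    also have "\<dots> = (\<Sum>k\<in>{p,q}. B $ a $ k * K $ k $ a - K $ a $ k * B $ k $ a)"
      by (rule sum.mono_neutral_right) (auto simp: K)
    finally show ?thesis using assms(1) by (auto simp: K)
  qed
  have "trace (diag_mat w ** C) = (\<Sum>a\<in>{p,q}. complex_of_real (w a) * C $ a $ a)"
    unfolding trace_def diag_mat_mult_nth
    by (rule sum.mono_neutral_right) (auto simp: C)
  moreover have re: "Re (cnj z * B $ p $ q) = Re (z * B $ q $ p)"
    using B[of p q] by (metis complex_cnj_mult complex_cnj_cnj cnj.sel(1))
  ultimately have "Re (trace (diag_mat w ** C)) = w p * Re (C $ p $ p) + w q * Re (C $ q $ q)"
    using assms(1) by simp
  also have "Re (C $ p $ p) = - 2 * Re (z * B $ q $ p)"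
    using re by (simp add: C del: times_complex.sel)
  also have "Re (C $ q $ q) = 2 * Re (z * B $ q $ p)"
    using re assms(1) by (simp add: C del: times_complex.sel)
  finally show ?thesis
    by (simp add: C_def algebra_simps)
qed

text \<open>Among all unitary \<open>U\<close>, one that maximises \<open>Re (trace (diag_mat w ** adjoint_mat U ** A ** U))\<close>
  diagonalises \<open>A\<close>, provided the weights \<open>w\<close> are distinct: rotations show that the commutator
  of \<open>diag_mat w\<close> and \<open>adjoint_mat U ** A ** U\<close> vanishes.\<close>

theorem hermitian_mat_spectral:
  fixes A :: "complex^'n^'n"
  assumes "hermitian_mat A"
  obtains U d where "unitary_mat U" "A = U ** diag_mat d ** adjoint_mat U"
proof -
  \<comment> \<open>Any injection into the naturals provides pairwise distinct weights.\<close>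
  obtain w0 :: "'n \<Rightarrow> nat" where w0: "inj w0"
    using finite_imp_inj_to_nat_seg[OF finite_class.finite_UNIV] by auto
  define w where "w k = real (w0 k)" for k
  define f where "f U = Re (trace (diag_mat w ** (adjoint_mat U ** A ** U)))" for U :: "complex^'n^'n"
  have "continuous_on {U. unitary_mat U} f"
    unfolding f_def
    by (intro continuous_on_Re linear_continuous_on_compose[OF _ bounded_linear.linear[OF bounded_linear_trace]]
        matrix_mult.continuous_on continuous_intros linear_continuous_on[OF bounded_linear_adjoint_mat])
  then obtain U where U: "unitary_mat U" and max: "\<And>V. unitary_mat V \<Longrightarrow> f V \<le> f U"
    using continuous_attains_sup[OF compact_unitary, of f] unitary_mat_1 by blast
  define B where "B = adjoint_mat U ** A ** U"
  have herm: "hermitian_mat B"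
    using assms by (simp add: hermitian_mat_def B_def adjoint_mat_mult matrix_mul_assoc)
  have off: "B $ q $ p = 0" if pq: "p \<noteq> q" for p q
  proof (rule ccontr)
    assume nz: "B $ q $ p \<noteq> 0"
    \<comment> \<open>The phase is chosen so that \<open>z * B $ q $ p\<close> is the modulus of the
      entry, which makes the derivative at 0 nonzero.\<close>
    define z where "z = cnj (sgn (B $ q $ p))"
    define K :: "complex^'n^'n"
      where "K = (\<chi> a b. if a = p \<and> b = q then z else if a = q \<and> b = p then - cnj z else 0)"
    have "cmod z = 1" using nz by (simp add: z_def norm_sgn)
    obtain G where G: "\<And>t. unitary_mat (G t)" "G 0 = mat 1" "(G has_vector_derivative K) (at 0)"
      by (rule rotation_path[OF pq \<open>cmod z = 1\<close> K_def]) blast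
    define h where "h t = trace (diag_mat w ** (adjoint_mat (G t) ** (B ** G t)))" for t
    have fh: "f (U ** G t) = Re (h t)" for t
      by (simp add: f_def h_def B_def adjoint_mat_mult matrix_mul_assoc)
    have adjK: "adjoint_mat K = - K"
      using pq by (auto simp: K_def vec_eq_iff)
    have "((\<lambda>t. adjoint_mat (G t)) has_vector_derivative - K) (at 0)"
      using bounded_linear.has_vector_derivative[OF bounded_linear_adjoint_mat G(3)] by (simp add: adjK)
    from matrix_mult.has_vector_derivative[OF this
        matrix_mult.has_vector_derivative[OF has_vector_derivative_const[of B] G(3)]]
    have "((\<lambda>t. adjoint_mat (G t) ** (B ** G t)) has_vector_derivative B ** K - K ** B) (at 0)"
      by (simp add: G(2) matrix_mult.minus_left)
    from bounded_linear.has_vector_derivative[OF bounded_linear_trace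
        matrix_mult.has_vector_derivative[OF has_vector_derivative_const[of "diag_mat w"] this]]
    have "(h has_vector_derivative trace (diag_mat w ** (B ** K - K ** B))) (at 0)"
      by (simp add: h_def[abs_def])
    from bounded_linear.has_vector_derivative[OF bounded_linear_Re this]
    have deriv: "((\<lambda>t. Re (h t)) has_real_derivative 2 * (w q - w p) * Re (z * B $ q $ p)) (at 0)"
      by (simp only: has_real_derivative_iff_has_vector_derivative trace_diag_commutator[OF pq K_def herm])
    \<comment> \<open>The path \<open>U ** G t\<close> stays among the unitary matrices and starts
      at the maximiser, so the derivative at 0 must vanish.\<close>
    have "Re (h t) \<le> Re (h 0)" for t
      using max[OF unitary_mat_mult[OF U G(1)[of t]]] fh[of t] fh[of 0] by (simp add: G(2))
    then have "2 * (w q - w p) * Re (z * B $ q $ p) = 0"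
      by (intro DERIV_local_max[OF deriv, of 1]) auto
    moreover have "w q \<noteq> w p" using w0 pq by (auto simp: w_def inj_def)
    moreover have "z * B $ q $ p = cmod (B $ q $ p)"
    proof -
      have "cnj (B $ q $ p) * B $ q $ p = complex_of_real (cmod (B $ q $ p)) * cmod (B $ q $ p)"
        using complex_norm_square[of "B $ q $ p"] by (simp add: mult.commute power2_eq_square)
      then show ?thesis
        using nz by (simp add: z_def sgn_eq field_simps)
    qed
    ultimately show False using nz by simp
  qed
  have diag: "B $ a $ a = complex_of_real (Re (B $ a $ a))" for a
    using herm by (metis adjoint_mat_nth hermitian_mat_def Reals_cnj_iff of_real_Re)
  have "B = diag_mat (\<lambda>a. Re (B $ a $ a))"
    using off diag by (auto simp: vec_eq_iff diag_mat_def)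
  moreover have "A = U ** B ** adjoint_mat U"
    using U by (simp add: B_def unitary_mat_def matrix_mul_assoc)
      (metis matrix_mul_assoc matrix_mul_rid matrix_mul_lid)
  ultimately show thesis using that[OF U] by metis
qed

section \<open>Quadratic forms and real powers\<close>

lemma quadratic_form_altdef:
  "quadratic_form A v = (\<Sum>k\<in>UNIV. \<Sum>l\<in>UNIV. cnj (v $ k) * A $ k $ l * v $ l)"
  by (simp add: quadratic_form_def matrix_vector_mult_def sum_distrib_left mult.assoc)

lemma quadratic_form_congruence:
  "quadratic_form (adjoint_mat V ** A ** V) v = quadratic_form A (V *v v)"
proof -
  define y where "y = A *v (V *v v)"
  have "quadratic_form (adjoint_mat V ** A ** V) v = (\<Sum>k\<in>UNIV. cnj (v $ k) * (adjoint_mat V *v y) $ k)"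
    by (simp add: quadratic_form_def y_def matrix_vector_mul_assoc matrix_mul_assoc)
  also have "\<dots> = (\<Sum>k\<in>UNIV. \<Sum>l\<in>UNIV. cnj (V $ l $ k * v $ k) * y $ l)"
    by (simp add: matrix_vector_mult_def sum_distrib_left mult_ac)
  also have "\<dots> = (\<Sum>l\<in>UNIV. \<Sum>k\<in>UNIV. cnj (V $ l $ k * v $ k) * y $ l)"
    by (rule sum.swap)
  also have "\<dots> = quadratic_form A (V *v v)"
    unfolding quadratic_form_def y_def[symmetric]
    by (simp add: matrix_vector_mult_def sum_distrib_right)
  finally show ?thesis .
qed

lemma quadratic_form_diag_mat:
  "quadratic_form (diag_mat d) v = complex_of_real (\<Sum>k\<in>UNIV. d k * (cmod (v $ k))\<^sup>2)"
proof -
  have "(diag_mat d *v v) $ k = complex_of_real (d k) * v $ k" for k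
    by (simp add: matrix_vector_mult_def diag_mat_def if_distrib[of "\<lambda>x. x * _"] cong: if_cong)
  then show ?thesis
    by (simp only: quadratic_form_def of_real_sum of_real_mult complex_norm_square mult_ac)
qed

lemma quadratic_form_scaleR: "quadratic_form A (c *\<^sub>R v) = c\<^sup>2 *\<^sub>R quadratic_form A v"
  by (simp add: quadratic_form_altdef scaleR_sum_right power2_eq_square)

text \<open>Only the zero vector needs an argument: by homogeneity with factor 0 the form vanishes
  there.\<close>

lemma positive_definite_imp_semidefinite: "positive_definite A \<Longrightarrow> positive_semidefinite A"
  unfolding positive_definite_def positive_semidefinite_def
  by (metis dual_order.strict_implies_order quadratic_form_scaleR order_refl
      power_zero_numeral scaleR_zero_left zero_complex.sel(1))

text \<open>The constant is the minimum of the form on the compact unit sphere; homogeneity extends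
  the bound to all vectors.\<close>

lemma positive_definite_coercive:
  fixes A :: "complex^'n^'n"
  assumes "positive_definite A"
  obtains c where "c > 0" "\<And>v. c * (norm v)\<^sup>2 \<le> Re (quadratic_form A v)"
proof -
  have cont: "continuous_on (sphere 0 1) (\<lambda>v. Re (quadratic_form A v))"
    unfolding quadratic_form_altdef by (intro continuous_intros)
  have "axis undefined 1 \<in> sphere (0 :: complex^'n) 1"
    by simp
  then obtain u where u: "norm u = 1"
    and min: "\<And>v :: complex^'n. norm v = 1 \<Longrightarrow> Re (quadratic_form A u) \<le> Re (quadratic_form A v)"
    using continuous_attains_inf[OF compact_sphere _ cont] by (metis empty_iff mem_sphere_0)
  show thesis
  proof
    show "Re (quadratic_form A u) > 0"
      using assms u unfolding positive_definite_def by (metis norm_zero zero_neq_one)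
    fix v
    show "Re (quadratic_form A u) * (norm v)\<^sup>2 \<le> Re (quadratic_form A v)"
    proof (cases "v = 0")
      case True
      then show ?thesis by (simp add: quadratic_form_altdef)
    next
      case False
      then have "Re (quadratic_form A u) \<le> Re (quadratic_form A (inverse (norm v) *\<^sub>R v))"
        by (intro min) simp
      then show ?thesis
        using False unfolding quadratic_form_scaleR by (simp add: field_simps)
    qed
  qed
qed

lemma unitary_mat_cancel:
  assumes "unitary_mat U"
  shows "adjoint_mat U ** U = mat 1" "U ** adjoint_mat U = mat 1"
    "A ** adjoint_mat U ** U = A" "A ** U ** adjoint_mat U = A"
  using assms by (simp_all add: unitary_mat_def matrix_mul_assoc[symmetric])

lemma unitary_mat_vector_eq_0:
  assumes "unitary_mat U" "U *v v = 0"
  shows "v = 0"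
  by (metis assms matrix_vector_mul_assoc matrix_vector_mul_lid matrix_vector_mult_0_right
      unitary_mat_cancel(1))

lemma unitary_mat_adjoint: "unitary_mat U \<Longrightarrow> unitary_mat (adjoint_mat U)"
  by (simp add: unitary_mat_def)

text \<open>The columns of \<open>U\<close> are eigenvectors, so sign conditions on the quadratic
  form pass to the eigenvalues.\<close>

lemma diag_congruence_entry:
  assumes "unitary_mat U" "A = U ** diag_mat d ** adjoint_mat U"
  shows "Re (quadratic_form A (U *v axis k 1)) = d k"
proof -
  have "adjoint_mat U ** A ** U = diag_mat d"
    using assms by (simp add: matrix_mul_assoc unitary_mat_cancel)
  then have "quadratic_form A (U *v axis k 1) = quadratic_form (diag_mat d) (axis k 1)"
    by (metis quadratic_form_congruence)
  then show ?thesis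
    by (simp add: quadratic_form_diag_mat axis_def if_distrib[of "\<lambda>x. _ * x"]
        if_distrib[of cmod] if_distrib[of "\<lambda>x. x ^ 2"] cong: if_cong)
qed

lemma positive_definite_spectral:
  fixes A :: "complex^'n^'n"
  assumes "positive_definite A"
  obtains U d where "unitary_mat U" "A = U ** diag_mat d ** adjoint_mat U" "\<And>k. d k > 0"
proof -
  obtain U d where U: "unitary_mat U" "A = U ** diag_mat d ** adjoint_mat U"
    using assms hermitian_mat_spectral unfolding positive_definite_def by metis
  have "U *v axis k 1 \<noteq> 0" for k
    using unitary_mat_vector_eq_0[OF U(1), of "axis k 1"] by (auto simp: axis_eq_0_iff)
  then have "d k > 0" for k
    using assms diag_congruence_entry[OF U, of k] unfolding positive_definite_def by metis
  with U that show thesis by blast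
qed

lemma mat_powr_add:
  assumes "positive_definite A"
  shows "mat_powr A s ** mat_powr A t = mat_powr A (s + t)"
proof -
  obtain U d where U: "unitary_mat U" "A = U ** diag_mat d ** adjoint_mat U" "\<And>k. d k > 0"
    by (rule positive_definite_spectral[OF assms]) blast
  show ?thesis
    unfolding mat_powr_eqI[OF U(1,2)]
    by (simp add: matrix_mul_assoc unitary_mat_cancel[OF U(1)] powr_add
        matrix_mul_assoc[symmetric, of U "diag_mat _" "diag_mat _"] diag_mat_mult)
qed

lemma mat_powr_0:
  assumes "positive_definite A"
  shows "mat_powr A 0 = mat 1"
proof -
  obtain U d where U: "unitary_mat U" "A = U ** diag_mat d ** adjoint_mat U" "\<And>k. d k > 0"
    by (rule positive_definite_spectral[OF assms]) blast
  \<comment> \<open>Positivity matters here because \<open>0 powr 0 = 0\<close>.\<close>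
  have "(\<lambda>k. d k powr 0) = (\<lambda>k. 1)"
    using U(3) by (auto simp: fun_eq_iff less_imp_neq[symmetric])
  then show ?thesis
    unfolding mat_powr_eqI[OF U(1,2)] by (simp add: diag_mat_1 unitary_mat_cancel[OF U(1)])
qed

lemma mat_powr_1:
  assumes "positive_definite A"
  shows "mat_powr A 1 = A"
proof -
  obtain U d where U: "unitary_mat U" "A = U ** diag_mat d ** adjoint_mat U" "\<And>k. d k > 0"
    by (rule positive_definite_spectral[OF assms]) blast
  have "(\<lambda>k. d k powr 1) = d"
    using U(3) by (auto simp: fun_eq_iff less_imp_le)
  then show ?thesis
    unfolding mat_powr_eqI[OF U(1,2)] by (simp add: U(2))
qed

lemma positive_definite_mat_powr:
  fixes A :: "complex^'n^'n"
  assumes "positive_definite A"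
  shows "positive_definite (mat_powr A s)"
proof -
  obtain U d where U: "unitary_mat U" "A = U ** diag_mat d ** adjoint_mat U" "\<And>k. d k > 0"
    by (rule positive_definite_spectral[OF assms]) blast
  have eq: "mat_powr A s = adjoint_mat (adjoint_mat U) ** diag_mat (\<lambda>k. d k powr s) ** adjoint_mat U"
    using mat_powr_eqI[OF U(1,2)] by simp
  have "Re (quadratic_form (mat_powr A s) v) > 0" if "v \<noteq> 0" for v
  proof -
    define w where "w = adjoint_mat U *v v"
    have "w \<noteq> 0"
      using that unitary_mat_vector_eq_0[OF unitary_mat_adjoint[OF U(1)]] w_def by metis
    then obtain k where "w $ k \<noteq> 0"
      by (auto simp: vec_eq_iff)
    then have "0 < d k powr s * (cmod (w $ k))\<^sup>2"
      using U(3)[of k] by simp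
    also have "\<dots> \<le> (\<Sum>k\<in>UNIV. d k powr s * (cmod (w $ k))\<^sup>2)"
      by (intro member_le_sum) auto
    also have "\<dots> = Re (quadratic_form (mat_powr A s) v)"
      by (simp only: eq quadratic_form_congruence quadratic_form_diag_mat w_def Re_complex_of_real)
    finally show ?thesis .
  qed
  moreover have "hermitian_mat (mat_powr A s)"
    by (simp add: eq hermitian_mat_def adjoint_mat_mult matrix_mul_assoc)
  ultimately show ?thesis by (simp add: positive_definite_def)
qed

text \<open>The eigenvalues are nonnegative, where \<open>powr 2\<close> is squaring. This evaluates
  the outer power of the sandwiched matrix.\<close>

lemma mat_powr_2:
  fixes X :: "complex^'n^'n"
  assumes "positive_semidefinite X"
  shows "mat_powr X 2 = X ** X"
proof -
  obtain U d where U: "unitary_mat U" "X = U ** diag_mat d ** adjoint_mat U"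
    using assms hermitian_mat_spectral unfolding positive_semidefinite_def by metis
  have "d k \<ge> 0" for k
    using assms diag_congruence_entry[OF U, of k] unfolding positive_semidefinite_def by metis
  then have "(\<lambda>k. d k powr 2) = (\<lambda>k. d k * d k)"
    by (auto simp: fun_eq_iff power2_eq_square[symmetric])
  then have "mat_powr X 2 = U ** (diag_mat d ** diag_mat d) ** adjoint_mat U"
    unfolding mat_powr_eqI[OF U] by (simp add: diag_mat_mult)
  also have "\<dots> = X ** X"
    unfolding U(2) by (simp add: matrix_mul_assoc unitary_mat_cancel[OF U(1)])
  finally show ?thesis .
qed

text \<open>For order 2 the inner exponent is -1/4, and cyclicity of the trace merges neighbouring
  factors \<open>Q\<close> into \<open>Q ** Q\<close>, the power -1/2.\<close>

lemma sandwiched_renyi_2: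
  fixes \<rho> \<sigma> :: "complex^'n^'n"
  assumes "positive_semidefinite \<rho>" "positive_definite \<sigma>"
  shows "sandwiched_renyi 2 \<rho> \<sigma> =
    ln (Re (trace (\<rho> ** mat_powr \<sigma> (- 1 / 2) ** (\<rho> ** mat_powr \<sigma> (- 1 / 2)))))"
proof -
  define Q where "Q = mat_powr \<sigma> (- (1 / 4))"
  have Q: "adjoint_mat Q = Q"
    using positive_definite_mat_powr[OF assms(2)] by (simp add: Q_def positive_definite_def hermitian_mat_def)
  have QQ: "Q ** Q = mat_powr \<sigma> (- 1 / 2)"
    by (simp add: Q_def mat_powr_add[OF assms(2)])
  have "positive_semidefinite (adjoint_mat Q ** \<rho> ** Q)"
    using assms(1) unfolding positive_semidefinite_def quadratic_form_congruence
    by (simp add: hermitian_mat_def adjoint_mat_mult matrix_mul_assoc)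
  then have "mat_powr (Q ** \<rho> ** Q) 2 = Q ** (\<rho> ** (Q ** Q) ** \<rho> ** Q)"
    by (simp add: Q mat_powr_2 matrix_mul_assoc)
  moreover have "trace \<dots> = trace (\<rho> ** (Q ** Q) ** (\<rho> ** (Q ** Q)))"
    by (subst trace_mul_sym) (simp add: matrix_mul_assoc)
  ultimately show ?thesis
    by (simp add: sandwiched_renyi_def Q_def[symmetric] QQ)
qed

section \<open>The Sylvester equation\<close>

lemma trace_eq_sum_quadratic_form:
  "trace M = (\<Sum>j\<in>UNIV. quadratic_form M (axis j 1))"
proof -
  have "quadratic_form M (axis j 1) = M $ j $ j" for j
    by (simp add: quadratic_form_def matrix_vector_mul_component axis_def matrix_vector_mult_def
        if_distrib[of "\<lambda>x. x * _"] if_distrib[of "\<lambda>x. _ * x"] if_distrib[of cnj] cong: if_cong)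
  then show ?thesis by (simp add: trace_def)
qed

lemma quadratic_form_mat_1: "quadratic_form (mat 1) v = complex_of_real ((norm v)\<^sup>2)"
  by (simp add: diag_mat_1[symmetric] quadratic_form_diag_mat norm_vec_def L2_set_def sum_nonneg)

text \<open>Pair the right-hand matrix with \<open>X\<close>: the first term sums the form of
  \<open>A\<close> over the columns of \<open>X\<close>, the second that of \<open>B\<close> over
  the columns of \<open>adjoint_mat X\<close>. Cauchy-Schwarz concludes. Allowing \<open>A\<close>
  and \<open>B\<close> to differ is what makes increments of square roots accessible.\<close>

lemma norm_sylvester_ge:
  fixes A B X :: "complex^'n^'n"
  assumes A: "\<And>v. c * (norm v)\<^sup>2 \<le> Re (quadratic_form A v)"
    and B: "\<And>v. 0 \<le> Re (quadratic_form B v)"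
  shows "c * norm X \<le> norm (A ** X + X ** B)"
proof (cases "X = 0")
  case False
  have "(norm X)\<^sup>2 = Re (trace (adjoint_mat X ** mat 1 ** X))"
    by (simp add: inner_matrix_eq_trace[symmetric] power2_norm_eq_inner)
  also have "c * \<dots> = (\<Sum>j\<in>UNIV. c * (norm (X *v axis j 1))\<^sup>2)"
    unfolding trace_eq_sum_quadratic_form quadratic_form_congruence quadratic_form_mat_1
    by (simp add: sum_distrib_left)
  also have "\<dots> \<le> (\<Sum>j\<in>UNIV. Re (quadratic_form A (X *v axis j 1)))"
    by (intro sum_mono A)
  also have "\<dots> = Re (trace (adjoint_mat X ** A ** X))"
    unfolding trace_eq_sum_quadratic_form quadratic_form_congruence by simp
  also have "\<dots> = inner X (A ** X)"
    by (simp add: inner_matrix_eq_trace matrix_mul_assoc)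
  finally have 1: "c * (norm X)\<^sup>2 \<le> inner X (A ** X)" .
  have "0 \<le> (\<Sum>j\<in>UNIV. Re (quadratic_form B (adjoint_mat X *v axis j 1)))"
    by (intro sum_nonneg B)
  also have "\<dots> = Re (trace (X ** B ** adjoint_mat X))"
    using quadratic_form_congruence[of "adjoint_mat X" B]
    unfolding trace_eq_sum_quadratic_form by simp
  also have "\<dots> = inner X (X ** B)"
    by (simp add: inner_matrix_eq_trace trace_mul_sym[of "adjoint_mat X"])
  finally have "c * (norm X)\<^sup>2 \<le> inner X (A ** X + X ** B)"
    using 1 by (simp add: inner_add_right)
  also have "\<dots> \<le> norm X * norm (A ** X + X ** B)"
    by (rule norm_cauchy_schwarz)
  finally show ?thesis
    using False by (simp add: power2_eq_square mult_ac)
qed simp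

text \<open>The norm estimate makes the Sylvester operator injective, hence surjective in finite
  dimension.\<close>

lemma sylvester_solution_exists:
  fixes A Z :: "complex^'n^'n"
  assumes "positive_definite A"
  obtains Y where "A ** Y + Y ** A = Z"
proof -
  obtain c where c: "c > 0" "\<And>v. c * (norm v)\<^sup>2 \<le> Re (quadratic_form A v)"
    by (rule positive_definite_coercive[OF assms]) blast
  have nonneg: "0 \<le> Re (quadratic_form A v)" for v
    using positive_definite_imp_semidefinite[OF assms(1)] by (simp add: positive_semidefinite_def)
  define L where "L Y = A ** Y + Y ** A" for Y
  have lin: "linear L"
    by (auto intro!: linearI simp: L_def matrix_mult.add_left matrix_mult.add_right
        matrix_mult.scaleR_left matrix_mult.scaleR_right scaleR_add_right)
  have "Y = 0" if "L Y = 0" for Y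
    using norm_sylvester_ge[OF c(2) nonneg, of Y] that c(1) by (simp add: L_def mult_le_0_iff)
  then have "inj L"
    using lin by (simp add: linear_injective_0)
  then have "surj L"
    using lin linear_injective_imp_surjective by blast
  then obtain Y where "L Y = Z"
    by (metis surjD)
  with that show thesis
    by (simp add: L_def)
qed

text \<open>Applied to increments, this yields the differentiability of square roots and their inverses.\<close>

lemma tendsto_sylvester:
  fixes A B Y Z :: "'a \<Rightarrow> complex^'n^'n"
  assumes "positive_definite A0" "A0 ** Y0 + Y0 ** A0 = Z0"
    and "(A \<longlongrightarrow> A0) F" "(B \<longlongrightarrow> A0) F" "(Z \<longlongrightarrow> Z0) F"
    and "eventually (\<lambda>x. A x ** Y x + Y x ** B x = Z x) F"
  shows "(Y \<longlongrightarrow> Y0) F"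
proof -
  obtain c where c: "c > 0" "\<And>v. c * (norm v)\<^sup>2 \<le> Re (quadratic_form A0 v)"
    by (rule positive_definite_coercive[OF assms(1)]) blast
  have nonneg: "0 \<le> Re (quadratic_form A0 v)" for v
    using positive_definite_imp_semidefinite[OF assms(1)] by (simp add: positive_semidefinite_def)
  obtain K where K: "K > 0" "\<And>X Y :: complex^'n^'n. norm (X ** Y :: complex^'n^'n) \<le> norm X * norm Y * K"
    using matrix_mult.pos_bounded by blast
  define e where "e x = K * (norm (A0 - A x) + norm (A0 - B x))" for x
  have "((\<lambda>x. K * (norm (A0 - A x) + norm (A0 - B x))) \<longlongrightarrow> K * (norm (A0 - A0) + norm (A0 - A0))) F"
    by (intro tendsto_intros assms)
  then have e: "(e \<longlongrightarrow> 0) F" by (simp add: e_def[abs_def])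
  have "((\<lambda>x. 2 / c * (norm (Z x - Z0) + e x * norm Y0)) \<longlongrightarrow> 2 / c * (norm (Z0 - Z0) + 0 * norm Y0)) F"
    by (intro tendsto_intros assms e)
  then have lim: "((\<lambda>x. 2 / c * (norm (Z x - Z0) + e x * norm Y0)) \<longlongrightarrow> 0) F"
    by simp
  \<comment> \<open>Below this threshold the error term containing \<open>norm W\<close> can be
    absorbed into the left-hand side \<open>c * norm W\<close>.\<close>
  have "eventually (\<lambda>x. e x < c / 2) F"
    using e c(1) by (intro order_tendstoD) auto
  then have "eventually (\<lambda>x. norm (Y x - Y0) \<le> 2 / c * (norm (Z x - Z0) + e x * norm Y0)) F"
    using assms(6)
  proof eventually_elim
    case (elim x)
    define W where "W = Y x - Y0"
    \<comment> \<open>The error solves the limiting equation, with the perturbation of the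
      coefficients moved to the right-hand side.\<close>
    have "A0 ** W + W ** A0 = (Z x - Z0) + (A0 - A x) ** Y x + Y x ** (A0 - B x)"
      by (simp add: W_def elim(2)[symmetric] assms(2)[symmetric] matrix_mult.diff_left matrix_mult.diff_right)
    then have "c * norm W \<le> norm ((Z x - Z0) + (A0 - A x) ** Y x + Y x ** (A0 - B x))"
      using norm_sylvester_ge[OF c(2) nonneg, of W] by simp
    also have "\<dots> \<le> norm (Z x - Z0) + norm ((A0 - A x) ** Y x) + norm (Y x ** (A0 - B x))"
      by norm
    also have "\<dots> \<le> norm (Z x - Z0) + norm (A0 - A x) * norm (Y x) * K + norm (Y x) * norm (A0 - B x) * K"
      by (intro add_mono K order_refl)
    also have "\<dots> = norm (Z x - Z0) + e x * norm (Y x)"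
      by (simp add: e_def algebra_simps)
    also have "\<dots> \<le> norm (Z x - Z0) + e x * (norm Y0 + norm W)"
    proof -
      have "norm (Y x) \<le> norm Y0 + norm W"
        unfolding W_def by norm
      moreover have "0 \<le> e x"
        using K(1) by (simp add: e_def)
      ultimately show ?thesis by (simp add: mult_left_mono)
    qed
    also have "\<dots> \<le> norm (Z x - Z0) + e x * norm Y0 + c / 2 * norm W"
      using mult_right_mono[of "e x" "c / 2" "norm W"] elim(1) by (simp add: algebra_simps)
    finally show ?case
      using c(1) by (simp add: W_def field_simps)
  qed
  then have "((\<lambda>x. Y x - Y0) \<longlongrightarrow> 0) F"
    by (rule Lim_null_comparison[OF _ lim])
  then show ?thesis by (simp add: LIM_zero_iff)
qed

section \<open>Derivatives along curves\<close>

text \<open>Difference quotients solve Sylvester equations, so this form lets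
  \<open>tendsto_sylvester\<close> yield derivatives.\<close>

lemma has_vector_derivative_iff_quotient:
  fixes f :: "real \<Rightarrow> 'a::real_normed_vector"
  shows "(f has_vector_derivative D) (at x) \<longleftrightarrow> ((\<lambda>y. (f y - f x) /\<^sub>R (y - x)) \<longlongrightarrow> D) (at x)"
proof -
  have "norm (f y - f x - (y - x) *\<^sub>R D) / norm (y - x) = norm ((f y - f x) /\<^sub>R (y - x) - D)"
    if "y \<noteq> x" for y
  proof -
    have "(f y - f x) /\<^sub>R (y - x) - D = (f y - f x - (y - x) *\<^sub>R D) /\<^sub>R (y - x)"
      using that by (simp add: scaleR_diff_right)
    then show ?thesis
      by (simp add: divide_inverse mult.commute)
  qed
  then have "eventually (\<lambda>y. norm (f y - f x - (y - x) *\<^sub>R D) / norm (y - x)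
      = norm ((f y - f x) /\<^sub>R (y - x) - D)) (at x)"
    by (simp add: eventually_at_filter)
  then have "(f has_vector_derivative D) (at x) \<longleftrightarrow>
      ((\<lambda>y. norm ((f y - f x) /\<^sub>R (y - x) - D)) \<longlongrightarrow> 0) (at x)"
    unfolding has_vector_derivative_def has_derivative_iff_norm
    by (simp add: bounded_linear_scaleR_left tendsto_cong)
  then show ?thesis
    by (simp add: tendsto_norm_zero_iff LIM_zero_iff)
qed

text \<open>Because \<open>f x = 0\<close>, the increment of the product is
  \<open>p (f y - f x) (g y)\<close>; hence continuity of \<open>g\<close> replaces its
  differentiability.\<close>

lemma has_vector_derivative_prod_zero:
  fixes f :: "real \<Rightarrow> _"
  assumes "bounded_bilinear p" "(f has_vector_derivative D) (at x)" "f x = 0" "isCont g x"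
  shows "((\<lambda>y. p (f y) (g y)) has_vector_derivative p D (g x)) (at x)"
proof -
  interpret bounded_bilinear p by fact
  have "((\<lambda>y. p ((f y - f x) /\<^sub>R (y - x)) (g y)) \<longlongrightarrow> p D (g x)) (at x)"
    using assms(2,4) by (intro tendsto) (auto simp: has_vector_derivative_iff_quotient isCont_def)
  then show ?thesis
    unfolding has_vector_derivative_iff_quotient by (simp add: assms(3) zero_left scaleR_left)
qed

text \<open>The increment of \<open>R\<close> solves a Sylvester equation with coefficients
  \<open>R x\<close> and \<open>R y\<close>. The norm estimate first gives continuity of
  \<open>R\<close>; then the limit lemma applies to the difference quotients.\<close>

lemma has_vector_derivative_sqrt:
  fixes R :: "real \<Rightarrow> complex^'n^'n"
  assumes pos: "\<And>y. positive_definite (R y)"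
    and deriv: "((\<lambda>y. R y ** R y) has_vector_derivative r') (at x)"
    and D: "R x ** D + D ** R x = r'"
  shows "(R has_vector_derivative D) (at x)"
proof -
  have eq: "R x ** (R y - R x) + (R y - R x) ** R y = R y ** R y - R x ** R x" for y
    by (simp add: matrix_mult.diff_left matrix_mult.diff_right)
  obtain c where c: "c > 0" "\<And>v. c * (norm v)\<^sup>2 \<le> Re (quadratic_form (R x) v)"
    by (rule positive_definite_coercive[OF pos]) blast
  have "0 \<le> Re (quadratic_form (R y) v)" for y v
    using positive_definite_imp_semidefinite[OF pos] by (simp add: positive_semidefinite_def)
  then have "c * norm (R y - R x) \<le> norm (R y ** R y - R x ** R x)" for y
    using norm_sylvester_ge[OF c(2), of "R y" "R y - R x"] by (simp add: eq)
  then have bound: "norm (R y - R x) \<le> norm (R y ** R y - R x ** R x) / c" for y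
    using c(1) by (simp add: field_simps)
  have "((\<lambda>y. norm (R y ** R y - R x ** R x) / c) \<longlongrightarrow> norm (R x ** R x - R x ** R x) / c) (at x)"
    using has_vector_derivative_continuous[OF deriv] c(1)
    by (intro tendsto_divide tendsto_norm tendsto_diff tendsto_const) (simp_all add: continuous_at)
  then have "((\<lambda>y. R y - R x) \<longlongrightarrow> 0) (at x)"
    by (intro Lim_null_comparison[OF always_eventually[OF allI[OF bound]]]) simp
  then have cont: "(R \<longlongrightarrow> R x) (at x)"
    by (simp add: LIM_zero_iff)
  have quot: "((\<lambda>y. (R y ** R y - R x ** R x) /\<^sub>R (y - x)) \<longlongrightarrow> r') (at x)"
    using deriv by (simp add: has_vector_derivative_iff_quotient)
  have "R x ** ((R y - R x) /\<^sub>R (y - x)) + ((R y - R x) /\<^sub>R (y - x)) ** R y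
      = (R y ** R y - R x ** R x) /\<^sub>R (y - x)" for y
    by (simp add: eq[symmetric] matrix_mult.scaleR_left matrix_mult.scaleR_right scaleR_add_right)
  then show ?thesis
    unfolding has_vector_derivative_iff_quotient
    by (intro tendsto_sylvester[OF pos D tendsto_const cont quot]) simp
qed

lemma has_vector_derivative_matrix_inverse:
  fixes R S :: "real \<Rightarrow> complex^'n^'n"
  assumes pos: "positive_definite (R x)"
    and deriv: "(R has_vector_derivative D) (at x)"
    and inv: "\<And>y. R y ** S y = mat 1" "\<And>y. S y ** R y = mat 1"
  shows "(S has_vector_derivative - (S x ** D ** S x)) (at x)"
proof -
  have R: "(R \<longlongrightarrow> R x) (at x)"
    using has_vector_derivative_continuous[OF deriv] by (simp add: continuous_at)
  have S: "(S \<longlongrightarrow> S x) (at x)"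
    \<comment> \<open>The inverse satisfies \<open>R S + S R = 1 + 1\<close>, again a Sylvester
      equation, so its continuity follows from that of \<open>R\<close>.\<close>
    by (rule tendsto_sylvester[OF pos _ R R tendsto_const[of "mat 1 + mat 1"]]) (simp_all add: inv)
  have "S y ** (R y - R x) ** S x = S x - S y" for y
    by (simp add: matrix_mult.diff_left matrix_mult.diff_right inv)
      (simp add: inv matrix_mul_assoc[symmetric])
  then have "- (S y ** ((R y - R x) /\<^sub>R (y - x)) ** S x) = (S y - S x) /\<^sub>R (y - x)" for y
    by (simp add: matrix_mult.scaleR_left matrix_mult.scaleR_right flip: scaleR_minus_right)
  moreover have "((\<lambda>y. - (S y ** ((R y - R x) /\<^sub>R (y - x)) ** S x)) \<longlongrightarrow> - (S x ** D ** S x)) (at x)"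
    using deriv unfolding has_vector_derivative_iff_quotient
    by (intro tendsto_minus matrix_mult.tendsto S tendsto_const)
  ultimately show ?thesis
    by (simp add: has_vector_derivative_iff_quotient)
qed

section \<open>The information matrix\<close>

theorem corollary23:
  fixes \<rho> :: "real^'l \<Rightarrow> complex^'n^'n" and \<theta> :: "real^'l" and i j :: 'l
  assumes "twice_differentiable \<rho>"
    and "\<And>\<eta>. state (\<rho> \<eta>)"
    and "\<And>\<eta>. positive_definite (\<rho> \<eta>)"
  shows "complex_of_real (sandwiched_renyi_info 2 \<rho> \<theta> $ i $ j) =
    trace (mat_powr (\<rho> \<theta>) (- 1 / 2) ** partial_deriv i \<rho> \<theta> **
           mat_powr (\<rho> \<theta>) (- 1 / 2) ** partial_deriv j \<rho> \<theta>)"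
proof -
  note pd = assms(3)
  note bl_trace = bounded_linear.has_vector_derivative[OF bounded_linear_trace]
  obtain \<rho>' :: "real^'l \<Rightarrow> (real^'l) \<Rightarrow>\<^sub>L (complex^'n^'n)"
    where \<rho>': "\<And>x. (\<rho> has_derivative \<rho>' x) (at x)" and \<rho>'_diff: "\<And>x. \<rho>' differentiable (at x)"
    using assms(1) unfolding twice_differentiable_def by blast

  \<comment> \<open>Square roots of the states and their inverses\<close>
  define R where "R \<eta> = mat_powr (\<rho> \<eta>) (1 / 2)" for \<eta>
  define S where "S \<eta> = mat_powr (\<rho> \<eta>) (- 1 / 2)" for \<eta>
  have RR: "R \<eta> ** R \<eta> = \<rho> \<eta>" for \<eta>
    by (simp add: R_def mat_powr_add[OF pd] mat_powr_1[OF pd])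
  have RS: "R \<eta> ** S \<eta> = mat 1" and SR: "S \<eta> ** R \<eta> = mat 1" for \<eta>
    by (simp_all add: R_def S_def mat_powr_add[OF pd] mat_powr_0[OF pd])
  have cancel: "R \<eta> ** (S \<eta> ** X) = X" "S \<eta> ** (R \<eta> ** X) = X" for \<eta> and X :: "complex^'n^'n"
    by (simp_all add: matrix_mul_assoc RS SR)
  note assoc = matrix_mul_assoc[symmetric]
  have Rpos: "positive_definite (R \<eta>)" for \<eta>
    unfolding R_def by (rule positive_definite_mat_powr[OF pd])
  have adjS: "adjoint_mat (S \<eta>) = S \<eta>" for \<eta>
    using positive_definite_mat_powr[OF pd] by (simp add: S_def positive_definite_def hermitian_mat_def)

  \<comment> \<open>First derivatives of the family\<close>
  define d\<rho> where "d\<rho> k \<eta> = \<rho>' \<eta> (axis k 1)" for k \<eta>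
  have d\<rho>: "((\<lambda>s. \<rho> (\<eta> + s *\<^sub>R axis k 1)) has_vector_derivative d\<rho> k \<eta>) (at 0)" for k \<eta>
  proof -
    have line: "((\<lambda>s. \<eta> + s *\<^sub>R axis k 1) has_derivative (\<lambda>s. s *\<^sub>R axis k 1)) (at 0)"
      by (auto intro!: derivative_eq_intros)
    have "((\<lambda>s. \<rho> (\<eta> + s *\<^sub>R axis k 1)) has_derivative (\<lambda>s. \<rho>' \<eta> (s *\<^sub>R axis k 1))) (at 0)"
      using has_derivative_compose[OF line, of \<rho> "\<rho>' \<eta>"] \<rho>' by simp
    then show ?thesis
      by (simp add: has_vector_derivative_def d\<rho>_def blinfun.scaleR_right)
  qed
  then have pd\<rho>: "partial_deriv k \<rho> \<eta> = d\<rho> k \<eta>" for k \<eta>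
    unfolding partial_deriv_def by (rule vector_derivative_at)
  have adj_d\<rho>: "adjoint_mat (d\<rho> k \<eta>) = d\<rho> k \<eta>" for k \<eta>
  proof -
    have "adjoint_mat (\<rho> \<eta>) = \<rho> \<eta>" for \<eta>
      using pd by (simp add: positive_definite_def hermitian_mat_def)
    then show ?thesis
      using bounded_linear.has_vector_derivative[OF bounded_linear_adjoint_mat d\<rho>[of \<eta> k]] d\<rho>[of \<eta> k]
      by (simp add: vector_derivative_unique_at)
  qed
  have trace_d\<rho>: "trace (d\<rho> k \<eta>) = 0" for k \<eta>
    using bl_trace[OF d\<rho>[of \<eta> k]] assms(2)
    by (simp add: state_def vector_derivative_unique_at[OF _ has_vector_derivative_const])
  define \<gamma> where "\<gamma> t = \<theta> + t *\<^sub>R axis i 1" for t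
  have \<gamma>0: "\<gamma> 0 = \<theta>" by (simp add: \<gamma>_def)
  \<comment> \<open>Second-order differentiability enters here, as continuity of
    \<open>\<rho>'\<close> at \<open>\<theta>\<close>.\<close>
  have cont_d\<rho>: "((\<lambda>t. d\<rho> j (\<gamma> t)) \<longlongrightarrow> d\<rho> j \<theta>) (at 0)"
  proof -
    have "(\<gamma> \<longlongrightarrow> \<theta> + 0 *\<^sub>R axis i 1) (at 0)"
      unfolding \<gamma>_def by (intro tendsto_intros)
    then have lim: "(\<gamma> \<longlongrightarrow> \<theta>) (at 0)"
      by simp
    have "isCont \<rho>' \<theta>"
      using \<rho>'_diff differentiable_imp_continuous_within by blast
    then have "((\<lambda>t. \<rho>' (\<gamma> t)) \<longlongrightarrow> \<rho>' \<theta>) (at 0)"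
      by (rule isCont_tendsto_compose[OF _ lim])
    then show ?thesis
      unfolding d\<rho>_def by (intro blinfun.tendsto tendsto_const)
  qed

  \<comment> \<open>Derivatives of the square root and of its inverse\<close>
  have "\<exists>D. R \<eta> ** D + D ** R \<eta> = d\<rho> k \<eta>" for k \<eta>
    using sylvester_solution_exists[OF Rpos] by metis
  then have "\<forall>k \<eta>. \<exists>D. R \<eta> ** D + D ** R \<eta> = d\<rho> k \<eta>"
    by blast
  then obtain D where D: "\<And>k \<eta>. R \<eta> ** D k \<eta> + D k \<eta> ** R \<eta> = d\<rho> k \<eta>"
    unfolding choice_iff by blast
  have dR: "((\<lambda>s. R (\<eta> + s *\<^sub>R axis k 1)) has_vector_derivative D k \<eta>) (at 0)" for k \<eta>
    by (rule has_vector_derivative_sqrt[OF Rpos, where r' = "d\<rho> k \<eta>"]) (simp_all add: RR d\<rho> D)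
  define T where "T k \<eta> = - (S \<eta> ** D k \<eta> ** S \<eta>)" for k \<eta>
  have dS: "((\<lambda>s. S (\<eta> + s *\<^sub>R axis k 1)) has_vector_derivative T k \<eta>) (at 0)" for k \<eta>
    using has_vector_derivative_matrix_inverse[OF Rpos dR[of \<eta> k], of "\<lambda>s. S (\<eta> + s *\<^sub>R axis k 1)"]
    by (simp add: RS SR T_def)
  have R\<gamma>: "((\<lambda>t. R (\<gamma> t)) has_vector_derivative D i \<theta>) (at 0)"
    and S\<gamma>: "((\<lambda>t. S (\<gamma> t)) has_vector_derivative T i \<theta>) (at 0)"
    unfolding \<gamma>_def by (rule dR dS)+
  have contR: "((\<lambda>t. R (\<gamma> t)) \<longlongrightarrow> R \<theta>) (at 0)" and contS: "((\<lambda>t. S (\<gamma> t)) \<longlongrightarrow> S \<theta>) (at 0)"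
    using R\<gamma>[THEN has_vector_derivative_continuous] S\<gamma>[THEN has_vector_derivative_continuous]
    by (simp_all add: continuous_at \<gamma>0)
  \<comment> \<open>\<open>D j\<close> solves a Sylvester equation whose coefficients and right-hand
    side converge along \<open>\<gamma>\<close>.\<close>
  have "((\<lambda>t. D j (\<gamma> t)) \<longlongrightarrow> D j \<theta>) (at 0)"
    by (rule tendsto_sylvester[OF Rpos D contR contR cont_d\<rho>]) (simp add: D)
  then have contT: "isCont (\<lambda>t. T j (\<gamma> t)) 0"
    unfolding isCont_def T_def \<gamma>0 by (intro tendsto_minus matrix_mult.tendsto contS)

  \<comment> \<open>First and second derivatives of the trace functional\<close>
  define \<Phi> where "\<Phi> \<eta> = trace (\<rho> \<theta> ** S \<eta> ** (\<rho> \<theta> ** S \<eta>))" for \<eta>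
  \<comment> \<open>By cyclicity both terms of the product rule for \<open>\<Phi>\<close> equal
    \<open>H k\<close>, whence the factor 2 below.\<close>
  define H where "H k \<eta> = trace (\<rho> \<theta> ** S \<eta> ** (\<rho> \<theta> ** T k \<eta>))" for k \<eta>
  have d\<Phi>: "((\<lambda>s. \<Phi> (\<eta> + s *\<^sub>R axis k 1)) has_vector_derivative 2 * H k \<eta>) (at 0)" for k \<eta>
  proof -
    have "((\<lambda>s. \<rho> \<theta> ** S (\<eta> + s *\<^sub>R axis k 1)) has_vector_derivative \<rho> \<theta> ** T k \<eta>) (at 0)"
      using matrix_mult.has_vector_derivative[OF has_vector_derivative_const[of "\<rho> \<theta>"] dS[of \<eta> k]] by simp
    from bl_trace[OF matrix_mult.has_vector_derivative[OF this this]] show ?thesis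
      by (simp add: \<Phi>_def H_def trace_add trace_mul_sym[of "\<rho> \<theta> ** T k \<eta>"])
  qed

  text \<open>Subtracting \<open>R\<^sup>3\<close> makes the factor in front of \<open>T\<^sub>k\<close> vanish at \<open>\<theta>\<close>. Hence \<open>H\<close> can be
    differentiated there although only the continuity of \<open>T\<^sub>k\<close> is established.\<close>

  define N where "N \<eta> = \<rho> \<theta> ** S \<eta> ** \<rho> \<theta> - R \<eta> ** R \<eta> ** R \<eta>" for \<eta>
  have N\<theta>: "N \<theta> = 0"
    by (simp add: N_def RR[symmetric] assoc cancel)
  have H_N: "H k \<eta> = trace (N \<eta> ** T k \<eta>)" for k \<eta>
  proof -
    have "trace (D k \<eta> ** R \<eta>) = trace (R \<eta> ** D k \<eta>)"
      by (rule trace_mul_sym)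
    then have "trace (R \<eta> ** D k \<eta>) = 0"
      using arg_cong[OF D[of \<eta> k], of trace] by (simp add: trace_add trace_d\<rho>)
    moreover have "trace (R \<eta> ** R \<eta> ** R \<eta> ** T k \<eta>) = - trace ((R \<eta> ** R \<eta> ** D k \<eta>) ** S \<eta>)"
      by (simp add: T_def matrix_mult.minus_right assoc cancel trace_def sum_negf)
    moreover have "trace ((R \<eta> ** R \<eta> ** D k \<eta>) ** S \<eta>) = trace (R \<eta> ** D k \<eta>)"
      by (subst trace_mul_sym) (simp add: assoc cancel)
    ultimately show ?thesis
      by (simp add: H_def N_def matrix_mult.diff_left trace_sub assoc)
  qed
  define a where "a = D i \<theta>"
  define b where "b = D j \<theta>"
  define r where "r = R \<theta>"
  define s where "s = S \<theta>"
  \<comment> \<open>The first summand is the derivative of \<open>\<rho> S \<rho>\<close>, since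
    \<open>\<rho> T \<rho> = - r a r\<close> at \<open>\<theta>\<close>; the other three come from
    the cube of \<open>R\<close>.\<close>
  define N' where "N' = - (r ** (a ** r) + a ** (r ** r) + r ** (a ** r) + r ** (r ** a))"
  have "((\<lambda>t. N (\<gamma> t)) has_vector_derivative N') (at 0)"
  proof -
    have 1: "((\<lambda>t. \<rho> \<theta> ** S (\<gamma> t) ** \<rho> \<theta>) has_vector_derivative - (r ** (a ** r))) (at 0)"
      using matrix_mult.has_vector_derivative[OF matrix_mult.has_vector_derivative[OF
            has_vector_derivative_const[of "\<rho> \<theta>"] S\<gamma>] has_vector_derivative_const[of "\<rho> \<theta>"]]
      by (simp add: T_def RR[symmetric] matrix_mult.minus_right matrix_mult.minus_left
          assoc cancel r_def a_def)
    have 2: "((\<lambda>t. R (\<gamma> t) ** R (\<gamma> t) ** R (\<gamma> t)) has_vector_derivative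
        r ** (r ** a) + (r ** (a ** r) + a ** (r ** r))) (at 0)"
      using matrix_mult.has_vector_derivative[OF matrix_mult.has_vector_derivative[OF R\<gamma> R\<gamma>] R\<gamma>]
      by (simp add: \<gamma>0 r_def a_def assoc matrix_mult.add_left)
    have "- (r ** (a ** r)) - (r ** (r ** a) + (r ** (a ** r) + a ** (r ** r))) = N'"
      by (simp add: N'_def)
    with has_vector_derivative_diff[OF 1 2] show ?thesis
      by (simp add: N_def)
  qed
  from bl_trace[OF has_vector_derivative_prod_zero[OF bounded_bilinear_matrix_mult this _ contT]]
  have dH: "((\<lambda>t. H j (\<gamma> t)) has_vector_derivative trace (N' ** T j \<theta>)) (at 0)"
    by (simp add: H_N N\<theta> \<gamma>0)
  have hessian: "trace (N' ** T j \<theta>) = trace (s ** d\<rho> i \<theta> ** s ** d\<rho> j \<theta>)"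
  proof -
    note can = cancel[of \<theta>, folded r_def s_def]
      RS[of \<theta>, folded r_def s_def] SR[of \<theta>, folded r_def s_def]
    \<comment> \<open>Used as rewrite rules, these bring all words to the cyclic representatives
      \<open>a b\<close>, \<open>a r b s\<close> and \<open>r a s b\<close>.\<close>
    have sym: "trace (r ** (a ** (b ** s))) = trace (a ** b)"
      "trace (r ** (r ** (a ** (s ** (b ** s))))) = trace (r ** (a ** (s ** b)))"
      "trace (s ** (a ** (b ** r))) = trace (a ** b)"
      "trace (s ** (a ** (r ** b))) = trace (a ** (r ** (b ** s)))"
      "trace (a ** (s ** (b ** r))) = trace (r ** (a ** (s ** b)))"
      using trace_mul_sym[of "r ** (a ** b)" s] trace_mul_sym[of "r ** (r ** (a ** (s ** b)))" s]
        trace_mul_sym[of "s ** (a ** b)" r] trace_mul_sym[of s "a ** (r ** b)"]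
        trace_mul_sym[of "a ** (s ** b)" r]
      by (simp_all add: assoc can)
    have "trace (N' ** T j \<theta>) =
        2 * trace (a ** b) + trace (a ** (r ** (b ** s))) + trace (r ** (a ** (s ** b)))"
      by (simp only: N'_def T_def b_def[symmetric] s_def[symmetric] matrix_mult.minus_left
          matrix_mult.minus_right minus_minus matrix_mult.add_left assoc can trace_add sym) simp
    also have "\<dots> = trace (s ** d\<rho> i \<theta> ** s ** d\<rho> j \<theta>)"
      by (simp add: D[symmetric] a_def[symmetric] b_def[symmetric] r_def[symmetric]
          matrix_mult.add_left matrix_mult.add_right assoc can trace_add sym)
    finally show ?thesis .
  qed
  \<comment> \<open>The adjoint reverses a product of Hermitian factors, and cyclicity restores the
    order. Reality allows \<open>Re\<close> to be dropped at the end.\<close>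
  have real: "trace (s ** d\<rho> i \<theta> ** s ** d\<rho> j \<theta>) \<in> \<real>"
  proof -
    have "cnj (trace (s ** d\<rho> i \<theta> ** s ** d\<rho> j \<theta>)) = trace (d\<rho> j \<theta> ** s ** (d\<rho> i \<theta> ** s))"
      by (simp add: trace_adjoint_mat[symmetric] adjoint_mat_mult adj_d\<rho> adjS s_def assoc)
    also have "\<dots> = trace (s ** (d\<rho> i \<theta> ** s ** d\<rho> j \<theta>))"
      using trace_mul_sym[of "d\<rho> j \<theta> ** s" "d\<rho> i \<theta> ** s"]
        trace_mul_sym[of s "d\<rho> i \<theta> ** s ** d\<rho> j \<theta>"] by (simp add: assoc)
    finally show ?thesis
      by (simp add: Reals_cnj_iff assoc)
  qed

  \<comment> \<open>Passage to the logarithm\<close>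
  define G where "G \<epsilon> = sandwiched_renyi 2 (\<rho> \<theta>) (\<rho> (\<theta> + \<epsilon>))" for \<epsilon>
  have G: "G \<epsilon> = ln (Re (\<Phi> (\<theta> + \<epsilon>)))" for \<epsilon>
    unfolding G_def \<Phi>_def S_def
    by (rule sandwiched_renyi_2[OF positive_definite_imp_semidefinite[OF pd] pd])
  \<comment> \<open>Positivity makes \<open>ln\<close> differentiable; along \<open>\<gamma>\<close>
    it holds near 0 by continuity, as \<open>\<Phi> \<theta> = 1\<close>.\<close>
  have dG: "partial_deriv j G \<epsilon> = 2 * Re (H j (\<theta> + \<epsilon>)) / Re (\<Phi> (\<theta> + \<epsilon>))"
    if "Re (\<Phi> (\<theta> + \<epsilon>)) > 0" for \<epsilon>
  proof -
    have "((\<lambda>s. Re (\<Phi> (\<theta> + \<epsilon> + s *\<^sub>R axis j 1))) has_real_derivative 2 * Re (H j (\<theta> + \<epsilon>))) (at 0)"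
      using bounded_linear.has_vector_derivative[OF bounded_linear_Re d\<Phi>[of "\<theta> + \<epsilon>" j]]
      by (simp add: has_real_derivative_iff_has_vector_derivative)
    from DERIV_ln[THEN DERIV_chain2, OF _ this] that
    have "((\<lambda>s. G (\<epsilon> + s *\<^sub>R axis j 1)) has_real_derivative
        2 * Re (H j (\<theta> + \<epsilon>)) / Re (\<Phi> (\<theta> + \<epsilon>))) (at 0)"
      by (simp add: G add.assoc field_simps)
    then show ?thesis
      unfolding partial_deriv_def has_real_derivative_iff_has_vector_derivative
      by (rule vector_derivative_at)
  qed
  have \<Phi>\<theta>: "\<Phi> \<theta> = 1"
  proof -
    have "\<Phi> \<theta> = trace (R \<theta> ** R \<theta>)"
      by (simp add: \<Phi>_def RR[symmetric] assoc cancel RS)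
    then show ?thesis
      using assms(2) by (simp add: RR state_def)
  qed
  have d\<Phi>\<gamma>: "((\<lambda>t. Re (\<Phi> (\<gamma> t))) has_real_derivative 2 * Re (H i \<theta>)) (at 0)"
    using bounded_linear.has_vector_derivative[OF bounded_linear_Re d\<Phi>[of \<theta> i]]
    by (simp add: has_real_derivative_iff_has_vector_derivative \<gamma>_def)
  have dH\<gamma>: "((\<lambda>t. 2 * Re (H j (\<gamma> t))) has_real_derivative 2 * Re (trace (N' ** T j \<theta>))) (at 0)"
    using bounded_linear.has_vector_derivative[OF bounded_linear_Re dH]
    by (intro DERIV_cmult) (simp add: has_real_derivative_iff_has_vector_derivative)
  \<comment> \<open>This removes the product of first derivatives from the quotient rule, so that
    \<open>ln\<close> leaves the second derivative unchanged.\<close>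
  have "H j \<theta> = 0"
    by (simp add: H_N N\<theta> trace_def)
  then have quot: "((\<lambda>t. 2 * Re (H j (\<gamma> t)) / Re (\<Phi> (\<gamma> t))) has_real_derivative
      2 * Re (trace (N' ** T j \<theta>))) (at 0)"
    using DERIV_divide[OF dH\<gamma> d\<Phi>\<gamma>] by (simp add: \<gamma>0 \<Phi>\<theta>)
  have "isCont (\<lambda>t. Re (\<Phi> (\<gamma> t))) 0"
    using d\<Phi>\<gamma> by (rule DERIV_isCont)
  then have "((\<lambda>t. Re (\<Phi> (\<gamma> t))) \<longlongrightarrow> 1) (nhds 0)"
    by (simp add: continuous_at isCont_def tendsto_nhds_iff \<gamma>0 \<Phi>\<theta>)
  then have "eventually (\<lambda>t. Re (\<Phi> (\<gamma> t)) > 0) (nhds 0)"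
    by (rule order_tendstoD) simp
  then have ev: "eventually (\<lambda>t. 2 * Re (H j (\<gamma> t)) / Re (\<Phi> (\<gamma> t)) =
      partial_deriv j G (0 + t *\<^sub>R axis i 1)) (nhds 0)"
    by eventually_elim (simp add: dG \<gamma>_def)
  from quot have "((\<lambda>t. partial_deriv j G (0 + t *\<^sub>R axis i 1)) has_real_derivative
      2 * Re (trace (N' ** T j \<theta>))) (at 0)"
    by (rule DERIV_cong_ev[OF refl ev refl, THEN iffD1])
  then have "partial_deriv i (partial_deriv j G) 0 = 2 * Re (trace (N' ** T j \<theta>))"
    unfolding has_real_derivative_iff_has_vector_derivative partial_deriv_def[of i]
    by (rule vector_derivative_at)
  \<comment> \<open>The prefactor 1/2 of the information matrix cancels the factor 2.\<close>
  then have "sandwiched_renyi_info 2 \<rho> \<theta> $ i $ j = Re (trace (s ** d\<rho> i \<theta> ** s ** d\<rho> j \<theta>))"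
    by (simp add: sandwiched_renyi_info_def G_def[abs_def] hessian)
  then show ?thesis
    using real by (simp add: of_real_Re pd\<rho> s_def S_def)
qed

end
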